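(* Let $R$ be a Noetherian commutative ring of prime characteristic $p>0$, let $I$ be a non-zero proper ideal of $R$, and let $\mathfrak{a}_\bullet=\{\mathfrak{a}_i\}_{i\ge 0}$ and $\mathfrak{b}_\bullet=\{\mathfrak{b}_i\}_{i\ge 0}$ be two filtrations of ideals in $R$ with $\mathfrak{a}_i\subseteq \mathfrak{b}_i$ for all $i\ge 1$. Then $\mathcal{C}_{+}^I(\mathfrak{a}_\bullet)\le \mathcal{C}_{+}^I(\mathfrak{b}_\bullet)$ and $\mathcal{C}_{-}^I(\mathfrak{a}_\bullet)\le \mathcal{C}_{-}^I(\mathfrak{b}_\bullet)$. Moreover, if the Rees algebra $\mathcal{R}(\mathfrak{b}_\bullet)$ is a finitely generated $\mathcal{R}(\mathfrak{a}_\bullet)$-module, then $\mathcal{C}_{+}^I(\mathfrak{a}_\bullet)=\mathcal{C}_{+}^I(\mathfrak{b}_\bullet)$ and $\mathcal{C}_{-}^I(\mathfrak{a}_\bullet)=\mathcal{C}_{-}^I(\mathfrak{b}_\bullet)$.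
   Context: A filtration of ideals in $R$ is a sequence $\mathfrak{a}_\bullet=\{\mathfrak{a}_i\}_{i\ge 0}$ of ideals with $\mathfrak{a}_0=R$, $\mathfrak{a}_{i+1}\subseteq\mathfrak{a}_i$ for all $i\ge 0$, and $\mathfrak{a}_i\mathfrak{a}_j\subseteq \mathfrak{a}_{i+j}$ for all $i,j\ge 0$. Its Rees algebra is $\mathcal{R}(\mathfrak{a}_\bullet)=\bigoplus_{i\ge 0}\mathfrak{a}_it^i\subseteq R[t]$. For an ideal $I$, $I^{[p^e]}$ is the ideal generated by all $f^{p^e}$, $f\in I$. For $e\ge 0$ put $\nu_{\mathfrak{a}_\bullet}^I(p^e)=\sup\{r\in\mathbb{Z}_{\ge 0}:\mathfrak{a}_r\not\subseteq I^{[p^e]}\}\in\mathbb{Z}_{\ge0}\cup\{\infty\}$, and define $\mathcal{C}_+^I(\mathfrak{a}_\bullet)=\limsup_{e\to\infty}\nu_{\mathfrak{a}_\bullet}^I(p^e)/p^e$ and $\mathcal{C}_-^I(\mathfrak{a}_\bullet)=\liminf_{e\to\infty}\nu_{\mathfrak{a}_\bullet}^I(p^e)/p^e$ (possibly $\infty$). *)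

theory Defs
  imports
    "HOL-Algebra.UnivPoly"
    "HOL-Algebra.Ring_Divisibility"
    "HOL-Algebra.Ideal_Product"
    "HOL-Algebra.Subrings"
    "HOL-Algebra.Multiplicative_Group"
    "HOL-Computational_Algebra.Primes"
    "HOL-Library.Extended_Real"
    "HOL-Library.Liminf_Limsup"
begin

text \<open>
  The characteristic is the additive order of \<open>\<one>\<close>; by the convention of \<open>group.ord\<close>
  it is \<open>0\<close> when no positive multiple of \<open>\<one>\<close> vanishes.
\<close>

definition ring_char :: "('a, 'm) ring_scheme \<Rightarrow> nat" where
  "ring_char R = group.ord (add_monoid R) \<one>\<^bsub>R\<^esub>"

lemma ring_char_dvd_iff:
  assumes "ring R"
  shows "ring_char R dvd n \<longleftrightarrow> [n] \<cdot>\<^bsub>R\<^esub> \<one>\<^bsub>R\<^esub> = \<zero>\<^bsub>R\<^esub>"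
proof -
  interpret ring R by fact
  show ?thesis
    using add.pow_eq_id[OF one_closed, of n] by (simp add: ring_char_def)
qed

definition ideal_filtration :: "('a, 'm) ring_scheme \<Rightarrow> (nat \<Rightarrow> 'a set) \<Rightarrow> bool" where
  "ideal_filtration R \<aa> \<longleftrightarrow>
     (\<forall>i. ideal (\<aa> i) R) \<and>
     \<aa> 0 = carrier R \<and>
     (\<forall>i. \<aa> (Suc i) \<subseteq> \<aa> i) \<and>
     (\<forall>i j. \<aa> i \<cdot>\<^bsub>R\<^esub> \<aa> j \<subseteq> \<aa> (i + j))"

definition frobenius_power :: "('a, 'm) ring_scheme \<Rightarrow> 'a set \<Rightarrow> nat \<Rightarrow> 'a set" where
  "frobenius_power R I q = Idl\<^bsub>R\<^esub> {f [^]\<^bsub>R\<^esub> q | f. f \<in> I}"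

text \<open>
  For a filtration and a proper ideal \<open>I\<close>, the index \<open>0\<close> always belongs to the set below,
  so the value of the supremum of the empty set plays no role.
\<close>

definition nu :: "('a, 'm) ring_scheme \<Rightarrow> 'a set \<Rightarrow> (nat \<Rightarrow> 'a set) \<Rightarrow> nat \<Rightarrow> enat" where
  "nu R I \<aa> q = (SUP r \<in> {r. \<not> \<aa> r \<subseteq> frobenius_power R I q}. enat r)"

definition C_plus ::
    "('a, 'm) ring_scheme \<Rightarrow> nat \<Rightarrow> 'a set \<Rightarrow> (nat \<Rightarrow> 'a set) \<Rightarrow> ereal" where
  "C_plus R p I \<aa> = limsup (\<lambda>e. ereal_of_enat (nu R I \<aa> (p ^ e)) / ereal (real (p ^ e)))"

definition C_minus ::
    "('a, 'm) ring_scheme \<Rightarrow> nat \<Rightarrow> 'a set \<Rightarrow> (nat \<Rightarrow> 'a set) \<Rightarrow> ereal" where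
  "C_minus R p I \<aa> = liminf (\<lambda>e. ereal_of_enat (nu R I \<aa> (p ^ e)) / ereal (real (p ^ e)))"

text \<open>
  The Rees algebra as a subring of \<open>R[t]\<close>.  The field \<open>smult\<close> inherited from \<open>UP R\<close>
  is the action of \<open>R\<close>.
\<close>

definition rees_algebra ::
    "('a, 'm) ring_scheme \<Rightarrow> (nat \<Rightarrow> 'a set) \<Rightarrow> ('a, nat \<Rightarrow> 'a) up_ring" where
  "rees_algebra R \<aa> =
     (UP R)\<lparr>carrier := {f \<in> carrier (UP R). \<forall>i. coeff (UP R) f i \<in> \<aa> i}\<rparr>"

text \<open>
  A ring with its own multiplication as scalar multiplication; restricting the scalars to a
  subring \<open>A\<close> of \<open>B\<close>, this is \<open>B\<close> as an \<open>A\<close>-module.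
\<close>

definition ring_as_module :: "('b, 'm) ring_scheme \<Rightarrow> ('b, 'b) module" where
  "ring_as_module B =
     \<lparr>carrier = carrier B, mult = mult B, one = one B, zero = zero B, add = add B,
      smult = mult B\<rparr>"

locale fin_gen_module = module +
  assumes finitely_generated:
    "\<exists>G. finite G \<and> G \<subseteq> carrier M \<and>
       (\<forall>x \<in> carrier M. \<exists>c \<in> G \<rightarrow> carrier R. x = (\<Oplus>\<^bsub>M\<^esub>g \<in> G. c g \<odot>\<^bsub>M\<^esub> g))"

lemma rees_algebra_subcring:
  assumes "cring R" and filt: "ideal_filtration R \<aa>"
  shows "subcring (carrier (rees_algebra R \<aa>)) (UP R)"
proof -
  interpret R: cring R by fact
  interpret P: cring "UP R" by (simp add: UP_cring.UP_cring UP_cring.intro assms(1))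
  interpret U: UP_cring R "UP R" by (simp add: UP_cring.intro assms(1))
  have id: "ideal (\<aa> i) R" for i using filt by (simp add: ideal_filtration_def)
  have mul: "x \<otimes>\<^bsub>R\<^esub> y \<in> \<aa> (i + j)" if "x \<in> \<aa> i" "y \<in> \<aa> j" for x y i j
    using filt ideal_prod.prod[OF that, of R] by (meson ideal_filtration_def subsetD)
  have z: "\<zero>\<^bsub>R\<^esub> \<in> \<aa> i" for i
    using id by (simp add: additive_subgroup.zero_closed ideal.axioms(1))
  have fs: "finsum R h A \<in> \<aa> i" if "finite A" "\<And>k. k \<in> A \<Longrightarrow> h k \<in> \<aa> i" for h i and A :: "nat set"
    using that
  proof (induction A rule: finite_induct)
    case empty then show ?case by (simp add: z)
  next
    case (insert x F)
    have "\<aa> i \<subseteq> carrier R"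
      using id by (simp add: additive_subgroup.a_subset ideal.axioms(1))
    then have "finsum R h (insert x F) = h x \<oplus>\<^bsub>R\<^esub> finsum R h F"
      using insert by (intro R.finsum_insert) auto
    then show ?case
      using insert id by (simp add: additive_subgroup.a_closed ideal.axioms(1))
  qed
  show ?thesis
  proof (rule P.subcringI', rule P.subringI, goal_cases)
    case 1 show ?case by (auto simp: rees_algebra_def)
  next
    case 2
    have "\<one>\<^bsub>R\<^esub> \<in> \<aa> 0" using filt by (simp add: ideal_filtration_def)
    then show ?case by (auto simp: rees_algebra_def z)
  next
    case (3 f) then show ?case
      by (auto simp: rees_algebra_def) (metis id additive_subgroup.a_inv_closed ideal.axioms(1) id R.is_abelian_group)
  next
    case (4 f g) then show ?case
      by (auto simp: rees_algebra_def
          intro!: fs) (metis mul le_add_diff_inverse)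
  next
    case (5 f g) then show ?case
      using id by (auto simp: rees_algebra_def additive_subgroup.a_closed ideal.axioms(1))
  qed
qed

lemma rees_algebra_module:
  assumes "cring R" "ideal_filtration R \<aa>" "ideal_filtration R \<bb>"
    and sub: "\<forall>i\<ge>1. \<aa> i \<subseteq> \<bb> i"
  shows "module (rees_algebra R \<aa>) (ring_as_module (rees_algebra R \<bb>))"
proof -
  interpret P: cring "UP R" by (simp add: UP_cring.UP_cring UP_cring.intro assms(1))
  interpret U: UP_cring R "UP R" by (simp add: UP_cring.intro assms(1))
  have cr: "cring (rees_algebra R \<cc>)" if "ideal_filtration R \<cc>" for \<cc>
    using P.subcring_iff[OF subcringE(1)[OF rees_algebra_subcring[OF assms(1) that]]]
      rees_algebra_subcring[OF assms(1) that] by (simp add: rees_algebra_def)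
  have "\<aa> i \<subseteq> \<bb> i" for i
    using assms by (cases i) (auto simp: ideal_filtration_def)
  then have AB: "carrier (rees_algebra R \<aa>) \<subseteq> carrier (rees_algebra R \<bb>)"
    by (auto simp: rees_algebra_def)
  interpret A: cring "rees_algebra R \<aa>" using cr assms by blast
  interpret B: cring "rees_algebra R \<bb>" using cr assms by blast
  have ops: "add (rees_algebra R \<aa>) = add (rees_algebra R \<bb>)"
    "mult (rees_algebra R \<aa>) = mult (rees_algebra R \<bb>)"
    "one (rees_algebra R \<aa>) = one (rees_algebra R \<bb>)"
    by (simp_all add: rees_algebra_def)
  have ab: "abelian_group (ring_as_module (rees_algebra R \<bb>))"
  proof (rule abelian_groupI, goal_cases)
    case (6 x)
    then show ?case
      by (auto simp: ring_as_module_def intro: B.l_neg bexI[of _ "\<ominus>\<^bsub>rees_algebra R \<bb>\<^esub> x"])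
  qed (auto simp: ring_as_module_def B.add.m_ac)
  show ?thesis
    by (intro moduleI ab A.is_cring)
      (auto simp: ring_as_module_def ops B.l_distr B.r_distr B.m_assoc subsetD[OF AB])
qed

end

theory Submission
  imports Defs
begin

text \<open>
  If finitely many generators of \<open>\<R>(\<bb>)\<close> over \<open>\<R>(\<aa>)\<close> have degree at most \<open>N\<close>, then comparing
  the coefficients of \<open>t\<^sup>k\<close> in an expression of \<open>f t\<^sup>k\<close>, where \<open>f \<in> \<bb>\<^sub>k\<close>, gives
  \<open>\<bb>\<^sub>k \<subseteq> \<aa>\<^bsub>k - N\<^esub>\<close>. Hence \<open>\<nu>\<^sub>\<bb> \<le> \<nu>\<^sub>\<aa> + N\<close>, and the bounded error \<open>N\<close> vanishes after division by \<open>p\<^sup>e\<close>.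
\<close>

lemma ideal_filtration_ideal: "ideal_filtration R \<aa> \<Longrightarrow> ideal (\<aa> i) R"
  by (simp add: ideal_filtration_def)

lemma ideal_filtration_antimono:
  assumes "ideal_filtration R \<aa>" "i \<le> j"
  shows "\<aa> j \<subseteq> \<aa> i"
  using assms(1) lift_Suc_antimono_le[of \<aa>, OF _ assms(2)] by (simp add: ideal_filtration_def)

text \<open>The inclusion extends to index 0 because both filtrations start with the whole
  ring.\<close>

lemma ideal_filtration_subset:
  assumes "ideal_filtration R \<aa>" "ideal_filtration R \<bb>" "\<forall>i\<ge>1. \<aa> i \<subseteq> \<bb> i"
  shows "\<aa> i \<subseteq> \<bb> i"
  using assms by (cases i) (auto simp: ideal_filtration_def)

text \<open>\<open>S\<close> may be infinite: \<open>finsum\<close> is then zero by convention,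
  which lies in \<open>A\<close>. The lemma serves for sums in the ring and for sums in the
  module.\<close>

lemma (in abelian_monoid) finsum_mem:
  assumes "A \<subseteq> carrier G" "\<zero> \<in> A" "\<And>x y. x \<in> A \<Longrightarrow> y \<in> A \<Longrightarrow> x \<oplus> y \<in> A"
    and "\<And>k. k \<in> S \<Longrightarrow> h k \<in> A"
  shows "finsum G h S \<in> A"
  using assms(4)
proof (induction S rule: infinite_finite_induct)
  case (insert x F)
  then have "finsum G h (insert x F) = h x \<oplus> finsum G h F"
    using assms(1) by (intro finsum_insert) auto
  then show ?case using insert assms(3) by simp
qed (simp_all add: assms(2))

text \<open>Subtraction on naturals truncates, so for \<open>k \<le> N\<close> the inclusion only
  says that \<open>\<bb> k\<close> lies in \<open>\<aa> 0\<close>, the whole ring.\<close>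

lemma rees_algebra_fin_gen_shift:
  assumes R: "cring R"
    and \<aa>: "ideal_filtration R \<aa>" and \<bb>: "ideal_filtration R \<bb>"
    and fg: "fin_gen_module (rees_algebra R \<aa>) (ring_as_module (rees_algebra R \<bb>))"
  shows "\<exists>N. \<forall>k. \<bb> k \<subseteq> \<aa> (k - N)"
proof -
  let ?A = "rees_algebra R \<aa>" and ?B = "rees_algebra R \<bb>"
  let ?M = "ring_as_module ?B"
  interpret R: cring R by fact
  interpret U: UP_cring R "UP R" by (simp add: UP_cring.intro R)
  interpret M: fin_gen_module ?A ?M by fact
  have carrier_M: "carrier ?M = {f \<in> carrier (UP R). \<forall>i. coeff (UP R) f i \<in> \<bb> i}"
    by (simp add: ring_as_module_def rees_algebra_def)
  have carrier_A: "carrier ?A = {f \<in> carrier (UP R). \<forall>i. coeff (UP R) f i \<in> \<aa> i}"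
    by (simp add: rees_algebra_def)
  have M_ops: "smult ?M = mult (UP R)" "add ?M = add (UP R)" "zero ?M = zero (UP R)"
    by (simp_all add: ring_as_module_def rees_algebra_def)
  have \<aa>_ideal: "ideal (\<aa> i) R" and \<bb>_ideal: "ideal (\<bb> i) R" for i
    using \<aa> \<bb> by (simp_all add: ideal_filtration_ideal)
  have \<aa>_sub: "\<aa> i \<subseteq> carrier R" and \<bb>_sub: "\<bb> i \<subseteq> carrier R"
    and \<aa>_zero: "\<zero>\<^bsub>R\<^esub> \<in> \<aa> i" and \<bb>_zero: "\<zero>\<^bsub>R\<^esub> \<in> \<bb> i"
    and \<aa>_add: "x \<in> \<aa> i \<Longrightarrow> y \<in> \<aa> i \<Longrightarrow> x \<oplus>\<^bsub>R\<^esub> y \<in> \<aa> i" for i x y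
    using ideal.axioms(1)[OF \<aa>_ideal] ideal.axioms(1)[OF \<bb>_ideal]
    by (simp_all add: additive_subgroup.a_subset additive_subgroup.zero_closed
        additive_subgroup.a_closed)
  obtain G where G: "finite G" "G \<subseteq> carrier ?M"
    and span: "\<And>x. x \<in> carrier ?M \<Longrightarrow>
      \<exists>c \<in> G \<rightarrow> carrier ?A. x = (\<Oplus>\<^bsub>?M\<^esub>g \<in> G. c g \<odot>\<^bsub>?M\<^esub> g)"
    using M.finitely_generated by blast
  \<comment> \<open>Any common bound on the degrees of the generators serves; the sum also covers
    empty \<open>G\<close>.\<close>
  define N where "N = (\<Sum>g\<in>G. deg R g)"
  have deg_N: "deg R g \<le> N" if "g \<in> G" for g
    unfolding N_def using that G(1) by (simp add: member_le_sum)
  have coeff_prod: "coeff (UP R) (c \<odot>\<^bsub>?M\<^esub> g) k \<in> \<aa> (k - N)"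
    if c: "c \<in> carrier ?A" and g: "g \<in> G" for c g k
  proof -
    have cU: "c \<in> carrier (UP R)" and gU: "g \<in> carrier (UP R)"
      using c g G(2) carrier_A carrier_M by auto
    have summand: "coeff (UP R) c i \<otimes>\<^bsub>R\<^esub> coeff (UP R) g (k - i) \<in> \<aa> (k - N)" if "i \<le> k" for i
    \<comment> \<open>Either \<open>c\<close> contributes a coefficient of index at least
      \<open>k - N\<close>, and the ideal absorbs the other factor, or the coefficient of
      \<open>g\<close> lies above its degree and vanishes.\<close>
    proof (cases "k - i \<le> N")
      case True
      then have "k - N \<le> i" by linarith
      then have "coeff (UP R) c i \<in> \<aa> (k - N)"
        using ideal_filtration_antimono[OF \<aa>, of "k - N" i] c carrier_A by auto
      then show ?thesis
        using ideal.I_r_closed[OF \<aa>_ideal] gU by simp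
    next
      case False
      then have "coeff (UP R) g (k - i) = \<zero>\<^bsub>R\<^esub>"
        using deg_N[OF g] gU by (intro U.deg_aboveD) auto
      then show ?thesis using cU \<aa>_zero by simp
    qed
    show ?thesis
      unfolding M_ops U.coeff_mult[OF cU gU]
      by (intro R.finsum_mem \<aa>_sub \<aa>_zero \<aa>_add summand) auto
  qed
  have "\<bb> k \<subseteq> \<aa> (k - N)" for k
  proof
    fix f assume f: "f \<in> \<bb> k"
    then have fR: "f \<in> carrier R" using \<bb>_sub by blast
    let ?x = "monom (UP R) f k"
    have "?x \<in> carrier ?M"
      using f fR \<bb>_zero by (simp add: carrier_M)
    then obtain c where c: "c \<in> G \<rightarrow> carrier ?A"
      and x: "?x = (\<Oplus>\<^bsub>?M\<^esub>g \<in> G. c g \<odot>\<^bsub>?M\<^esub> g)"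
      using span by blast
    have "(\<Oplus>\<^bsub>?M\<^esub>g \<in> G. c g \<odot>\<^bsub>?M\<^esub> g) \<in>
        {h \<in> carrier ?M. coeff (UP R) h k \<in> \<aa> (k - N)}"
    \<comment> \<open>The condition on the coefficient of index \<open>k\<close> is additive and
      holds for zero, so it passes from the summands to the sum. For the monomial \<open>?x\<close>
      this coefficient is \<open>f\<close>.\<close>
    proof (rule M.finsum_mem)
      fix g assume g: "g \<in> G"
      then show "c g \<odot>\<^bsub>?M\<^esub> g \<in> {h \<in> carrier ?M. coeff (UP R) h k \<in> \<aa> (k - N)}"
        using c G(2) coeff_prod[of "c g" g k] by auto
    next
      fix x y assume xy: "x \<in> {h \<in> carrier ?M. coeff (UP R) h k \<in> \<aa> (k - N)}"
        "y \<in> {h \<in> carrier ?M. coeff (UP R) h k \<in> \<aa> (k - N)}"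
      then have "x \<oplus>\<^bsub>?M\<^esub> y \<in> carrier ?M" by simp
      moreover have "x \<in> carrier (UP R)" "y \<in> carrier (UP R)"
        using xy carrier_M by auto
      ultimately show "x \<oplus>\<^bsub>?M\<^esub> y \<in> {h \<in> carrier ?M. coeff (UP R) h k \<in> \<aa> (k - N)}"
        using xy by (simp add: M_ops \<aa>_add)
    next
      show "\<zero>\<^bsub>?M\<^esub> \<in> {h \<in> carrier ?M. coeff (UP R) h k \<in> \<aa> (k - N)}"
        using M.zero_closed by (simp add: M_ops \<aa>_zero)
    qed auto
    then show "f \<in> \<aa> (k - N)"
      using fR by (simp flip: x)
  qed
  then show ?thesis by blast
qed

text \<open>If \<open>\<bb> r\<close> escapes the Frobenius power, so does the larger ideal
  \<open>\<aa> (r - N)\<close>, and \<open>r \<le> (r - N) + N\<close> even when the subtraction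
  truncates. Working in \<open>enat\<close> covers infinite suprema.\<close>

lemma nu_shift:
  assumes "\<forall>k. \<bb> k \<subseteq> \<aa> (k - N)"
  shows "nu R I \<bb> q \<le> nu R I \<aa> q + enat N"
  unfolding nu_def[of R I \<bb>]
proof (rule SUP_least)
  fix r assume "r \<in> {r. \<not> \<bb> r \<subseteq> frobenius_power R I q}"
  then have "\<not> \<aa> (r - N) \<subseteq> frobenius_power R I q"
    using assms by blast
  then have "enat (r - N) \<le> nu R I \<aa> q"
    unfolding nu_def by (intro SUP_upper) simp
  then have "enat (r - N) + enat N \<le> nu R I \<aa> q + enat N"
    by (rule add_right_mono)
  moreover have "enat r \<le> enat (r - N) + enat N" by simp
  ultimately show "enat r \<le> nu R I \<aa> q + enat N" by (rule order_trans[rotated])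
qed

text \<open>Eventually the error is below any fixed \<open>d > 0\<close>. A real constant can be
  pulled out of an upper or lower limit even if that limit is infinite, and \<open>d\<close> is
  arbitrary.\<close>

lemma Limsup_Liminf_le_perturbed:
  fixes u v :: "nat \<Rightarrow> ereal"
  assumes le: "\<And>n. u n \<le> v n + ereal (\<epsilon> n)" and \<epsilon>: "\<epsilon> \<longlonglongrightarrow> 0"
  shows "limsup u \<le> limsup v" and "liminf u \<le> liminf v"
proof -
  have ev: "\<forall>\<^sub>F n in sequentially. u n \<le> v n + ereal d" if "d > 0" for d
    using order_tendstoD(2)[OF \<epsilon> that]
  proof eventually_elim
    case (elim n)
    then have "v n + ereal (\<epsilon> n) \<le> v n + ereal d" by (intro add_left_mono) simp
    then show ?case using le order_trans by blast
  qed
  show "limsup u \<le> limsup v"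
  proof (rule ereal_le_epsilon2)
    fix d :: real assume "d > 0"
    then show "limsup u \<le> limsup v + ereal d"
      using Limsup_mono[OF ev] by (simp add: Limsup_add_ereal_right)
  qed
  show "liminf u \<le> liminf v"
  proof (rule ereal_le_epsilon2)
    fix d :: real assume "d > 0"
    then show "liminf u \<le> liminf v + ereal d"
      using Liminf_mono[OF ev] by (simp add: Liminf_add_ereal_right)
  qed
qed

text \<open>Dividing the bound of \<open>nu_shift\<close> by \<open>p ^ e\<close> leaves the error
  \<open>N / p ^ e\<close>, which tends to zero as \<open>p > 1\<close>.\<close>

lemma C_shift:
  assumes p: "p > 1" and shift: "\<forall>k. \<bb> k \<subseteq> \<aa> (k - N)"
  shows "C_plus R p I \<bb> \<le> C_plus R p I \<aa>" and "C_minus R p I \<bb> \<le> C_minus R p I \<aa>"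
proof -
  let ?c = "\<lambda>\<cc> e. ereal_of_enat (nu R I \<cc> (p ^ e)) / ereal (real (p ^ e))"
  have "?c \<bb> e \<le> ?c \<aa> e + ereal (real N / real (p ^ e))" for e
  proof -
    have "ereal_of_enat (nu R I \<bb> (p ^ e)) \<le> ereal_of_enat (nu R I \<aa> (p ^ e) + enat N)"
      using nu_shift[OF shift] by simp
    then have "?c \<bb> e \<le> (ereal_of_enat (nu R I \<aa> (p ^ e)) + ereal (real N)) / ereal (real (p ^ e))"
      using p by (intro ereal_divide_right_mono) (simp_all add: ereal_of_enat_add)
    \<comment> \<open>If \<open>nu\<close> is infinite, both sides are \<infinity>; otherwise this
      is distributivity over the reals.\<close>
    also have "\<dots> = ?c \<aa> e + ereal (real N / real (p ^ e))"
      using p by (cases "nu R I \<aa> (p ^ e)") (simp_all add: add_divide_distrib)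
    finally show ?thesis .
  qed
  moreover have "(\<lambda>e. real N / real (p ^ e)) \<longlonglongrightarrow> 0"
    using LIMSEQ_divide_realpow_zero[of "real p" "real N"] p by simp
  ultimately show "C_plus R p I \<bb> \<le> C_plus R p I \<aa>" "C_minus R p I \<bb> \<le> C_minus R p I \<aa>"
    unfolding C_plus_def C_minus_def by (rule Limsup_Liminf_le_perturbed)+
qed

theorem theorem3p5:
  fixes R :: "('a, 'm) ring_scheme"
    and p :: nat
    and I :: "'a set"
    and \<aa> \<bb> :: "nat \<Rightarrow> 'a set"
  assumes "cring R"
    and "noetherian_ring R"
    and "Factorial_Ring.prime p"
    and "ring_char R = p"
    and "ideal I R"
    and "I \<noteq> {\<zero>\<^bsub>R\<^esub>}"
    and "I \<noteq> carrier R"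
    and "ideal_filtration R \<aa>"
    and "ideal_filtration R \<bb>"
    and "\<forall>i\<ge>1. \<aa> i \<subseteq> \<bb> i"
  shows "C_plus R p I \<aa> \<le> C_plus R p I \<bb> \<and>
    C_minus R p I \<aa> \<le> C_minus R p I \<bb> \<and>
    (fin_gen_module (rees_algebra R \<aa>) (ring_as_module (rees_algebra R \<bb>)) \<longrightarrow>
      C_plus R p I \<aa> = C_plus R p I \<bb> \<and>
      C_minus R p I \<aa> = C_minus R p I \<bb>)"
proof -
  have p: "p > 1" using assms(3) by (rule prime_gt_1_nat)
  \<comment> \<open>Monotonicity is the case of shift 0, with the roles of the two filtrations
    exchanged.\<close>
  have "\<forall>k. \<aa> k \<subseteq> \<bb> (k - 0)"
    using ideal_filtration_subset[OF assms(8-10)] by simp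
  note le = C_shift[OF p this]
  moreover have "C_plus R p I \<bb> \<le> C_plus R p I \<aa> \<and> C_minus R p I \<bb> \<le> C_minus R p I \<aa>"
    if fg: "fin_gen_module (rees_algebra R \<aa>) (ring_as_module (rees_algebra R \<bb>))"
  proof -
    obtain N where "\<forall>k. \<bb> k \<subseteq> \<aa> (k - N)"
      using rees_algebra_fin_gen_shift[OF assms(1,8,9) fg] by blast
    then show ?thesis using C_shift[OF p] by blast
  qed
  ultimately show ?thesis by (auto intro: order_antisym)
qed

end
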